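(* Let $X(t)$, $t\in\mathbb{R}^d$, be a stochastically continuous, jointly measurable and separable real-valued random process, let $z\in\mathbb{R}$, and let $\mathscr{A}\subset\mathbb{R}^d$ be a bounded open set. Put $\mathcal{M}(\mathscr{A},X)=\sup_{t\in\mathscr{A}}X(t)$. Suppose that $\mathbb{P}\{\mathcal{M}(\mathscr{A},X)\ge z\}>0$, that $\mathbb{P}\{X(t)=z\}=0$ for all $t\in\mathscr{A}$, and that $$\mathbb{P}\left\{\mathcal{M}(\mathscr{A},X)\ge z,\ \int_{\mathscr{A}}\mathbb{I}(X(t)\ge z)\,\lambda(dt)=0\right\}=0.$$ Then the distribution of $\mathcal{M}(\mathscr{A},X)$ is continuous at $z$, i.e. $\mathbb{P}\{\mathcal{M}(\mathscr{A},X)=z\}=0$.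
   Context: $\lambda$ is Lebesgue measure on $\mathbb{R}^d$ and $\mathbb{I}(\cdot)$ is the indicator function. Stochastic continuity means that for every $t\in\mathbb{R}^d$, $X(s)\to X(t)$ in probability as $s\to t$. Joint measurability means that $(\omega,t)\mapsto X(t)(\omega)$ is jointly measurable. Separability means that there are a countable dense set $D\subset\mathbb{R}^d$ (a separant) and a null event $N$ such that for every open $G\subset\mathbb{R}^d$ and every closed $F\subset\mathbb{R}$ the sets $\{X(t)\in F\ \forall t\in G\cap D\}$ and $\{X(t)\in F\ \forall t\in G\}$ differ only by a subset of $N$; in particular $\sup_{t\in\mathscr{A}}X(t)=\sup_{t\in\mathscr{A}\cap D}X(t)$ almost surely for open $\mathscr{A}$. The supremum may take the value $+\infty$. *)

theory Defs
  imports "HOL-Probability.Probability"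
begin

text \<open>
  A process on \<open>\<real>\<^sup>d\<close> is a family \<open>X t \<omega>\<close> over a probability space \<open>M\<close>, with time argument
  first. The index type \<open>'d\<close> plays the role of the dimension.
\<close>

definition stochastically_continuous ::
    "'w measure \<Rightarrow> (real ^ 'd \<Rightarrow> 'w \<Rightarrow> real) \<Rightarrow> bool" where
  "stochastically_continuous M X \<longleftrightarrow>
     (\<forall>t. \<forall>\<epsilon>>0. ((\<lambda>s. measure M {\<omega> \<in> space M. \<bar>X s \<omega> - X t \<omega>\<bar> > \<epsilon>}) \<longlongrightarrow> 0) (at t))"

definition jointly_measurable ::
    "'w measure \<Rightarrow> (real ^ 'd \<Rightarrow> 'w \<Rightarrow> real) \<Rightarrow> bool" where
  "jointly_measurable M X \<longleftrightarrow> (\<lambda>(\<omega>, t). X t \<omega>) \<in> borel_measurable (M \<Otimes>\<^sub>M borel)"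

text \<open>
  The set \<open>{X(t) \<in> F for all t \<in> G}\<close> is an uncountable intersection and need not lie in
  \<open>sets M\<close>; only its symmetric difference with its countable counterpart is
  required to be contained in the null event \<open>N\<close>.
\<close>

definition separable_process ::
    "'w measure \<Rightarrow> (real ^ 'd \<Rightarrow> 'w \<Rightarrow> real) \<Rightarrow> bool" where
  "separable_process M X \<longleftrightarrow>
     (\<exists>D N. countable D \<and> closure D = UNIV \<and> N \<in> null_sets M \<and>
       (\<forall>G F. open G \<longrightarrow> closed F \<longrightarrow>
         sym_diff {\<omega> \<in> space M. \<forall>t \<in> G \<inter> D. X t \<omega> \<in> F}
                  {\<omega> \<in> space M. \<forall>t \<in> G. X t \<omega> \<in> F} \<subseteq> N))"

definition process_sup ::
    "(real ^ 'd) set \<Rightarrow> (real ^ 'd \<Rightarrow> 'w \<Rightarrow> real) \<Rightarrow> 'w \<Rightarrow> ereal" where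
  "process_sup A X \<omega> = (SUP t\<in>A. ereal (X t \<omega>))"

text \<open>
  For a separable process the supremum over an open set is a random variable on the completed
  space, so probabilities of events involving it are taken with respect to
  \<open>completion M\<close>, which agrees with \<open>M\<close> on \<open>sets M\<close>
  (and is \<open>M\<close> itself when \<open>M\<close> is complete).
\<close>

lemma process_sup_measurable:
  assumes X: "\<And>t. X t \<in> borel_measurable M"
    and sep: "separable_process M X" and A: "open A"
  shows "process_sup A X \<in> borel_measurable (completion M)"
proof -
  obtain D N where D: "countable D" and N: "N \<in> null_sets M"
    and s: "\<forall>G F. open G \<longrightarrow> closed F \<longrightarrow>
         sym_diff {\<omega> \<in> space M. \<forall>t \<in> G \<inter> D. X t \<omega> \<in> F}
                  {\<omega> \<in> space M. \<forall>t \<in> G. X t \<omega> \<in> F} \<subseteq> N"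
    using sep unfolding separable_process_def by (elim exE conjE) (rule that)
  define S where "S = process_sup (A \<inter> D) X"
  have S: "S \<in> borel_measurable M"
    unfolding S_def process_sup_def using D X by (intro borel_measurable_SUP) auto
  have eq: "process_sup A X \<omega> = S \<omega>" if w: "\<omega> \<in> space M" "\<omega> \<notin> N" for \<omega>
  proof (rule antisym)
    show "S \<omega> \<le> process_sup A X \<omega>"
      unfolding S_def process_sup_def by (rule SUP_subset_mono) auto
    show "process_sup A X \<omega> \<le> S \<omega>"
    proof (rule ereal_le_real)
      fix c assume "S \<omega> \<le> ereal c"
      then have "\<forall>t\<in>A \<inter> D. X t \<omega> \<in> {..c}"
        unfolding S_def process_sup_def by (auto simp: SUP_le_iff)
      then have "\<omega> \<in> {\<omega> \<in> space M. \<forall>t \<in> A \<inter> D. X t \<omega> \<in> {..c}}"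
        using w by simp
      moreover have "sym_diff {\<omega> \<in> space M. \<forall>t \<in> A \<inter> D. X t \<omega> \<in> {..c}}
                  {\<omega> \<in> space M. \<forall>t \<in> A. X t \<omega> \<in> {..c}} \<subseteq> N"
        using s A closed_atMost by blast
      ultimately have "\<omega> \<in> {\<omega> \<in> space M. \<forall>t \<in> A. X t \<omega> \<in> {..c}}"
        using w(2) by blast
      then show "process_sup A X \<omega> \<le> ereal c"
        unfolding process_sup_def by (auto simp: SUP_le_iff)
    qed
  qed
  show ?thesis
  proof (rule measurableI)
    fix B :: "ereal set" assume B: "B \<in> sets borel"
    let ?P = "process_sup A X -` B \<inter> space M"
    have P: "?P = (S -` B \<inter> space M - N) \<union> (?P \<inter> N)" using eq by auto
    have "S -` B \<inter> space M - N \<in> sets (completion M)"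
      using measurable_sets[OF S B] N
      by (intro sets_completionI_sets sets.Diff) (auto simp: null_sets_def)
    moreover have "?P \<inter> N \<in> sets (completion M)"
      using N by (intro sets_completionI_sub[of N]) auto
    ultimately have "?P \<in> sets (completion M)"
      by (subst P) (rule sets.Un)
    then show "process_sup A X -` B \<inter> space (completion M) \<in> sets (completion M)"
      by simp
  qed simp
qed

end

theory Submission
  imports Defs
begin

text \<open>
  Where the supremum equals \<open>z\<close>, the path never exceeds \<open>z\<close> on \<open>A\<close>, so the time it spends in
  \<open>{z..}\<close> is the time it spends at \<open>z\<close>. By Fubini the latter is almost surely zero, which
  the hypothesis on the occupation time of \<open>{z..}\<close> excludes up to a null event.
\<close>

text \<open>Tonelli's theorem asks for measurability on the product with \<open>lborel\<close>,
  while joint measurability is stated with \<open>borel\<close>. Both products have the same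
  measurable sets, so the claim transfers.\<close>

lemma borel_measurable_occupation:
  fixes A :: "'t :: euclidean_space set" and X :: "'t \<Rightarrow> 'w \<Rightarrow> 'b :: topological_space"
  assumes "(\<lambda>(\<omega>, t). X t \<omega>) \<in> borel_measurable (M \<Otimes>\<^sub>M borel)"
    and "A \<in> sets borel" and "B \<in> sets borel"
  shows "(\<lambda>(\<omega>, t). indicator B (X t \<omega>) * indicator A t :: ennreal)
           \<in> borel_measurable (M \<Otimes>\<^sub>M lborel)"
proof -
  have eq: "sets (M \<Otimes>\<^sub>M lborel) = sets (M \<Otimes>\<^sub>M borel)"
    by (intro sets_pair_measure_cong) simp_all
  have [measurable]: "(\<lambda>p. X (snd p) (fst p)) \<in> borel_measurable (M \<Otimes>\<^sub>M borel)"
    using assms(1) by (simp add: case_prod_beta')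
  note [measurable] = assms(2,3)
  have "(\<lambda>(\<omega>, t). indicator B (X t \<omega>) * indicator A t :: ennreal)
           \<in> borel_measurable (M \<Otimes>\<^sub>M borel)"
    unfolding case_prod_beta' by measurable
  then show ?thesis
    by (simp add: measurable_cong_sets[OF eq refl])
qed

text \<open>By Tonelli, the integral over \<open>M\<close> of the occupation time of
  \<open>B\<close> is the integral over \<open>t\<close> in \<open>A\<close> of the measure of the
  event that \<open>X t\<close> lies in \<open>B\<close>, which is 0. A nonnegative function with
  zero integral vanishes almost everywhere.\<close>

lemma AE_occupation_eq_0:
  fixes A :: "'t :: euclidean_space set" and X :: "'t \<Rightarrow> 'w \<Rightarrow> 'b :: topological_space"
  assumes "sigma_finite_measure M"
    and X: "(\<lambda>(\<omega>, t). X t \<omega>) \<in> borel_measurable (M \<Otimes>\<^sub>M borel)"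
    and A: "A \<in> sets borel" and B: "B \<in> sets borel"
    and null: "\<And>t. t \<in> A \<Longrightarrow> AE \<omega> in M. X t \<omega> \<notin> B"
  shows "AE \<omega> in M. (\<integral>\<^sup>+ t\<in>A. indicator B (X t \<omega>) \<partial>lborel) = 0"
proof -
  interpret M: sigma_finite_measure M by fact
  interpret pair_sigma_finite M lborel ..
  note m = borel_measurable_occupation[OF X A B]
  have "(\<integral>\<^sup>+ \<omega>. (\<integral>\<^sup>+ t\<in>A. indicator B (X t \<omega>) \<partial>lborel) \<partial>M)
      = (\<integral>\<^sup>+ t. (\<integral>\<^sup>+ \<omega>. indicator B (X t \<omega>) * indicator A t \<partial>M) \<partial>lborel)"
    using Fubini'[OF m] by simp
  also have "\<dots> = (\<integral>\<^sup>+ (t :: 't). 0 \<partial>lborel)"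
  proof (rule nn_integral_cong)
    fix t
    \<comment> \<open>The exceptional null set may depend on \<open>t\<close>; this is harmless, as
      \<open>t\<close> is fixed in the inner integral.\<close>
    have "AE \<omega> in M. indicator B (X t \<omega>) * indicator A t = (0 :: ennreal)"
    proof (cases "t \<in> A")
      case True
      from null[OF this] show ?thesis by eventually_elim simp
    qed simp
    then show "(\<integral>\<^sup>+ \<omega>. indicator B (X t \<omega>) * indicator A t \<partial>M) = 0"
      by (subst nn_integral_cong_AE[where v = "\<lambda>_. 0"]) simp_all
  qed
  finally have "(\<integral>\<^sup>+ \<omega>. (\<integral>\<^sup>+ t\<in>A. indicator B (X t \<omega>) \<partial>lborel) \<partial>M) = 0"
    by simp
  then show ?thesis
    using lborel.borel_measurable_nn_integral[OF m] by (subst (asm) nn_integral_0_iff_AE) simp_all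
qed

theorem corollary2p2:
  fixes M :: "'w measure"
    and X :: "real ^ 'd \<Rightarrow> 'w \<Rightarrow> real"
    and z :: real
    and A :: "(real ^ 'd) set"
  assumes "prob_space M"
    and "\<And>t. X t \<in> borel_measurable M"
    and "stochastically_continuous M X"
    and "jointly_measurable M X"
    and "separable_process M X"
    and "bounded A" and "open A"
    and "measure (completion M) {\<omega> \<in> space M. process_sup A X \<omega> \<ge> ereal z} > 0"
    and "\<And>t. t \<in> A \<Longrightarrow> measure M {\<omega> \<in> space M. X t \<omega> = z} = 0"
    and "measure (completion M)
           {\<omega> \<in> space M. process_sup A X \<omega> \<ge> ereal z \<and>
              (\<integral>\<^sup>+ t\<in>A. indicator {z..} (X t \<omega>) \<partial>lborel) = 0} = 0"
  shows "measure (completion M) {\<omega> \<in> space M. process_sup A X \<omega> = ereal z} = 0"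
proof -
  interpret M: prob_space M by fact
  let ?S = "process_sup A X"
  let ?occ = "\<lambda>B \<omega>. \<integral>\<^sup>+ t\<in>A. indicator B (X t \<omega>) \<partial>lborel"
  have X: "(\<lambda>(\<omega>, t). X t \<omega>) \<in> borel_measurable (M \<Otimes>\<^sub>M borel)"
    using assms(4) by (simp add: jointly_measurable_def)
  have A: "A \<in> sets borel"
    using \<open>open A\<close> by simp
  \<comment> \<open>Separability enters here: it reduces the uncountable supremum to a countable
    one, up to a null event. Hence the rest of the argument is carried out in the
    completion.\<close>
  have [measurable]: "?S \<in> borel_measurable (completion M)"
    using assms(2,5) \<open>open A\<close> by (rule process_sup_measurable)
  have [measurable]: "?occ {z..} \<in> borel_measurable (completion M)"
    using lborel.borel_measurable_nn_integral[OF borel_measurable_occupation[OF X A, of "{z..}"]]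
    by (intro measurable_completion) simp
  have "AE \<omega> in M. X t \<omega> \<notin> {z}" if "t \<in> A" for t
  proof -
    have "{\<omega> \<in> space M. X t \<omega> = z} \<in> sets M"
      using assms(2) by measurable
    then show ?thesis
      using assms(9)[OF that] by (simp add: AE_iff_measurable[OF _ refl] M.emeasure_eq_measure)
  qed
  then have "AE \<omega> in M. ?occ {z} \<omega> = 0"
    by (intro AE_occupation_eq_0[OF M.sigma_finite_measure_axioms X A]) simp_all
  then have "AE \<omega> in completion M. ?occ {z} \<omega> = 0"
    by (rule AE_completion)
  moreover have "AE \<omega> in completion M. \<not> (?S \<omega> \<ge> ereal z \<and> ?occ {z..} \<omega> = 0)"
  proof -
    \<comment> \<open>\<open>measure\<close> is also 0 on non-measurable sets, so the assumed value
      0 gives a null set only together with measurability.\<close>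
    have "{\<omega> \<in> space (completion M). ?S \<omega> \<ge> ereal z \<and> ?occ {z..} \<omega> = 0}
        \<in> sets (completion M)"
      by measurable
    then have "{\<omega> \<in> space M. ?S \<omega> \<ge> ereal z \<and> ?occ {z..} \<omega> = 0} \<in> null_sets (completion M)"
      using assms(10) by (simp add: null_sets_def measure_def enn2real_eq_0_iff)
    then show ?thesis
      by (rule AE_I') auto
  qed
  ultimately have "AE \<omega> in completion M. ?S \<omega> \<noteq> ereal z"
  proof eventually_elim
    case (elim \<omega>)
    show ?case
    proof
      assume sup: "?S \<omega> = ereal z"
      then have "X t \<omega> \<le> z" if "t \<in> A" for t
        using that by (simp add: process_sup_def) (metis SUP_upper ereal_less_eq(3))
      \<comment> \<open>For values at most \<open>z\<close>, lying in \<open>{z..}\<close> means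
        being equal to \<open>z\<close>; outside \<open>A\<close> both integrands are 0.\<close>
      then have "?occ {z..} \<omega> = ?occ {z} \<omega>"
        by (intro nn_integral_cong) (force split: split_indicator)
      with elim sup show False by simp
    qed
  qed
  moreover have "{\<omega> \<in> space (completion M). ?S \<omega> = ereal z} \<in> sets (completion M)"
    by measurable
  ultimately show ?thesis
    by (simp add: AE_iff_measurable[OF _ refl] measure_def)
qed

end
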